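(* Let $\mathbf{y}_{1:n}$ be the random output trajectory of the stochastic dynamical system $\Phi$, and let $\mathscr{F}$ be an online probabilistic predictor with one-step predictive densities $\hat{p}_{\mathbf{y}_k\mid\mathbf{y}_{1:k-1}}$. Then the expected log-likelihood functional is upper-bounded: $$\mathcal{L}(\mathscr{F},\mathbf{y}_{1:n})\le-\mathrm{H}(\mathbf{y}_{1:n}),$$ and equality holds if and only if $p_{\mathbf{y}_k\mid\mathbf{y}_{1:k-1}}=\hat{p}_{\mathbf{y}_k\mid\mathbf{y}_{1:k-1}}$ (for $k=1,\dots,n$) in the sense of the Lebesgue measure.
   Context: System $\Phi$: $\mathbf{x}_k=f(\mathbf{x}_{k-1},\mathbf{u}_{k-1})+\mathbf{w}_{k-1}$, $\mathbf{y}_k=h(\mathbf{x}_k)+\mathbf{v}_k$, with states $\mathbf{x}_k\in\mathbb{R}^{d_x}$, inputs $\mathbf{u}_k\in\mathbb{R}^{d_u}$, independent process noises $\mathbf{w}_k\in\mathbb{R}^{d_x}$, outputs $\mathbf{y}_k\in\mathbb{R}^{d_y}$, independent observation noises $\mathbf{v}_k\in\mathbb{R}^{d_y}$; there is no cross-correlation among $\mathbf{w}_k,\mathbf{v}_k,\mathbf{u}_k$, and $\mathbf{x}_0$ is independent of them. Random vectors are described by probability density functions; $p_{\mathbf{y}_k\mid\mathbf{y}_{1:k-1}}$ is the true conditional density. Notation $(\cdot)_{1:k}=(\cdot)_1,\dots,(\cdot)_k$. Predictor: an online probabilistic predictor $\mathscr{F}=(\mathscr{F}_k)_{k=1}^n$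 with information set $\mathcal{I}$ (whatever it knows about $f,h$ and the distributions of the random vectors) outputs at time $k$, from the observed $y_{1:k-1}$, a probability density $\mathscr{F}_k(y_{1:k-1};\mathcal{I})=\hat{p}_{\mathbf{y}_k\mid\mathbf{y}_{1:k-1}}(\cdot\mid y_{1:k-1})$ on $\mathbb{R}^{d_y}$. Log-likelihood functional: $\mathcal{L}(\mathscr{F},y_{1:n}):=\sum_{k=1}^n\log\hat{p}_{\mathbf{y}_k\mid\mathbf{y}_{1:k-1}}(y_k\mid y_{1:k-1})$. Expected log-likelihood functional: $\mathcal{L}(\mathscr{F},\mathbf{y}_{1:n}):=\mathbb{E}_{y_{1:n}}\mathcal{L}(\mathscr{F},y_{1:n})$, with $y_{1:n}$ distributed as $\mathbf{y}_{1:n}$ (true law). $\mathrm{H}(\mathbf{y}_{1:n}):=-\int p_{\mathbf{y}_{1:n}}\log p_{\mathbf{y}_{1:n}}$ is the joint differential entropy.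
   Formalization: The equality characterization is stated only when the joint differential entropy H is finite; for infinite H the "only if" fails (if H is +infinity, every predictor attains equality). The upper bound is stated without this condition. *)

theory Defs
  imports "HOL-Probability.Probability"
begin

section \<open>Stochastic dynamical systems\<close>

datatype source = Initial | Input | Process nat | Observation nat

text \<open>
  The sigma-algebras generated by the random sources of the system.  The whole input sequence
  counts as one source, so inputs at different times may depend on each other.
\<close>
fun source_events ::
  "'s measure \<Rightarrow> ('s \<Rightarrow> 'x::euclidean_space) \<Rightarrow> (nat \<Rightarrow> 's \<Rightarrow> 'u::euclidean_space) \<Rightarrow>
    (nat \<Rightarrow> 's \<Rightarrow> 'x) \<Rightarrow> (nat \<Rightarrow> 's \<Rightarrow> 'y::euclidean_space) \<Rightarrow> source \<Rightarrow> 's set set"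
where
  "source_events M x0 u w v Initial = sets (vimage_algebra (space M) x0 borel)"
| "source_events M x0 u w v Input =
    sets (vimage_algebra (space M) (\<lambda>\<omega> k. u k \<omega>) (PiM UNIV (\<lambda>_. borel)))"
| "source_events M x0 u w v (Process k) = sets (vimage_algebra (space M) (w k) borel)"
| "source_events M x0 u w v (Observation k) = sets (vimage_algebra (space M) (v k) borel)"

text \<open>
  States, inputs and process noises are indexed from \<open>0\<close>; outputs and observation noises are
  indexed from \<open>1\<close>, and \<open>y 0\<close>, \<open>v 0\<close> are unconstrained dummies.
\<close>
locale stochastic_system = prob_space M
  for M :: "'s measure"
    and f :: "'x::euclidean_space \<Rightarrow> 'u::euclidean_space \<Rightarrow> 'x"
    and h :: "'x \<Rightarrow> 'y::euclidean_space"
    and x :: "nat \<Rightarrow> 's \<Rightarrow> 'x"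
    and u :: "nat \<Rightarrow> 's \<Rightarrow> 'u"
    and w :: "nat \<Rightarrow> 's \<Rightarrow> 'x"
    and v :: "nat \<Rightarrow> 's \<Rightarrow> 'y"
    and y :: "nat \<Rightarrow> 's \<Rightarrow> 'y" +
  assumes f_measurable: "case_prod f \<in> borel \<Otimes>\<^sub>M borel \<rightarrow>\<^sub>M borel"
    and h_measurable: "h \<in> borel \<rightarrow>\<^sub>M borel"
    and state_eq: "\<And>k \<omega>. 1 \<le> k \<Longrightarrow> \<omega> \<in> space M \<Longrightarrow>
          x k \<omega> = f (x (k - 1) \<omega>) (u (k - 1) \<omega>) + w (k - 1) \<omega>"
    and output_eq: "\<And>k \<omega>. 1 \<le> k \<Longrightarrow> \<omega> \<in> space M \<Longrightarrow> y k \<omega> = h (x k \<omega>) + v k \<omega>"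
    and initial_density: "\<exists>q. distributed M lborel (x 0) q"
    and input_density: "\<And>k. \<exists>q. distributed M lborel (u k) q"
    and process_density: "\<And>k. \<exists>q. distributed M lborel (w k) q"
    and observation_density: "\<And>k. 1 \<le> k \<Longrightarrow> \<exists>q. distributed M lborel (v k) q"
    and independent: "indep_sets (source_events M (x 0) u w v)
          ({Initial, Input} \<union> range Process \<union> Observation ` {1..})"

section \<open>Output trajectories and their densities\<close>

definition traj_space :: "nat \<Rightarrow> (nat \<Rightarrow> 'y::euclidean_space) measure" where
  "traj_space k = PiM {1..k} (\<lambda>_. lborel)"

definition traj :: "(nat \<Rightarrow> 's \<Rightarrow> 'y) \<Rightarrow> nat \<Rightarrow> 's \<Rightarrow> nat \<Rightarrow> 'y" where
  "traj y k \<omega> = (\<lambda>i\<in>{1..k}. y i \<omega>)"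

definition traj_law :: "'s measure \<Rightarrow> (nat \<Rightarrow> 's \<Rightarrow> 'y::euclidean_space) \<Rightarrow> nat \<Rightarrow> (nat \<Rightarrow> 'y) measure"
where
  "traj_law M y k = distr M (traj_space k) (traj y k)"

definition joint_densities ::
  "'s measure \<Rightarrow> (nat \<Rightarrow> 's \<Rightarrow> 'y::euclidean_space) \<Rightarrow> nat \<Rightarrow> (nat \<Rightarrow> (nat \<Rightarrow> 'y) \<Rightarrow> real) \<Rightarrow> bool"
where
  "joint_densities M y n p \<longleftrightarrow>
    (\<forall>k\<le>n. (\<forall>\<eta>\<in>space (traj_space k). 0 \<le> p k \<eta>) \<and>
      distributed M (traj_space k) (traj y k) (\<lambda>\<eta>. ennreal (p k \<eta>)))"

text \<open>
  Density of the \<open>k\<close>-th output at \<open>z\<close> given the history \<open>\<eta>\<close> of the outputs \<open>1, \<dots>, k - 1\<close>; only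
  meaningful where \<open>p (k - 1) \<eta> > 0\<close>, which holds for almost every history under its law.
\<close>
definition cond_density :: "(nat \<Rightarrow> (nat \<Rightarrow> 'y) \<Rightarrow> real) \<Rightarrow> nat \<Rightarrow> (nat \<Rightarrow> 'y) \<Rightarrow> 'y \<Rightarrow> real" where
  "cond_density p k \<eta> z = p k (\<eta>(k := z)) / p (k - 1) \<eta>"

section \<open>Extended-real integrals and differential entropy\<close>

text \<open>
  The usual integral with values in the extended reals.  It is well-defined unless both parts
  are infinite; in that case the value is \<open>\<infinity> - \<infinity> = \<infinity>\<close> (for type \<^typ>\<open>ereal\<close>), so
  that an upper bound below \<open>\<infinity>\<close> also says that the integral is well-defined.
\<close>
definition ext_integral :: "'a measure \<Rightarrow> ('a \<Rightarrow> ereal) \<Rightarrow> ereal" where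
  "ext_integral M g =
    enn2ereal (\<integral>\<^sup>+ a. e2ennreal (g a) \<partial>M) - enn2ereal (\<integral>\<^sup>+ a. e2ennreal (- g a) \<partial>M)"

definition diff_entropy :: "nat \<Rightarrow> (nat \<Rightarrow> (nat \<Rightarrow> 'y::euclidean_space) \<Rightarrow> real) \<Rightarrow> ereal" where
  "diff_entropy n p = - ext_integral (traj_space n) (\<lambda>\<eta>. ereal (p n \<eta> * ln (p n \<eta>)))"

lemma ext_integral_eq_integral:
  assumes "integrable M g"
  shows "ext_integral M (\<lambda>a. ereal (g a)) = ereal (\<integral>a. g a \<partial>M)"
proof -
  have fin: "(\<integral>\<^sup>+ a. ennreal (g a) \<partial>M) \<noteq> \<infinity>" "(\<integral>\<^sup>+ a. ennreal (- g a) \<partial>M) \<noteq> \<infinity>"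
    using assms by (auto simp: real_integrable_def)
  have *: "enn2ereal t = ereal (enn2real t)" if "t \<noteq> \<infinity>" for t
    using that by (cases t) auto
  show ?thesis
    unfolding ext_integral_def real_lebesgue_integral_def[OF assms]
    using *[OF fin(1)] *[OF fin(2)] by (simp flip: ennreal.abs_eq)
qed

text \<open>When finite, the entropy is the library's \<^const>\<open>prob_space.entropy\<close> in base \<open>e\<close>.\<close>
lemma diff_entropy_eq_entropy:
  assumes "prob_space M" and "joint_densities M y n p"
    and "integrable (traj_space n) (\<lambda>\<eta>. p n \<eta> * ln (p n \<eta>))"
  shows "diff_entropy n p = ereal (prob_space.entropy M (exp 1) (traj_space n) (traj y n))"
proof -
  interpret information_space M "exp 1"
    using assms(1) by (simp add: information_space_def information_space_axioms_def)
  have "entropy (exp 1) (traj_space n) (traj y n) =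
      - (\<integral>\<eta>. p n \<eta> * log (exp 1) (p n \<eta>) \<partial>traj_space n)"
    using assms(2) by (intro entropy_distr) (auto simp: joint_densities_def)
  then show ?thesis
    unfolding diff_entropy_def ext_integral_eq_integral[OF assms(3)]
    by (simp add: log_def)
qed

section \<open>Online probabilistic predictors and the log-likelihood functional\<close>

text \<open>
  \<open>F k \<eta> I\<close> is the density predicted for the \<open>k\<close>-th output from the observed history \<open>\<eta>\<close> and
  the information set \<open>I\<close>, which is an arbitrary object.
\<close>
definition online_predictor ::
  "nat \<Rightarrow> (nat \<Rightarrow> (nat \<Rightarrow> 'y::euclidean_space) \<Rightarrow> 'i \<Rightarrow> 'y \<Rightarrow> real) \<Rightarrow> 'i \<Rightarrow> bool"
where
  "online_predictor n F I \<longleftrightarrow>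
    (\<forall>k\<in>{1..n}.
      (\<lambda>(\<eta>, z). F k \<eta> I z) \<in> borel_measurable (traj_space (k - 1) \<Otimes>\<^sub>M lborel) \<and>
      (\<forall>\<eta>\<in>space (traj_space (k - 1)).
        (\<forall>z. 0 \<le> F k \<eta> I z) \<and> (\<integral>\<^sup>+ z. ennreal (F k \<eta> I z) \<partial>lborel) = 1))"

text \<open>The logarithm on \<open>[0, \<infinity>)\<close> with \<open>log 0 = -\<infinity>\<close>, unlike \<^term>\<open>ln (0::real) = 0\<close>.\<close>
definition ext_ln :: "real \<Rightarrow> ereal" where
  "ext_ln t = (if t = 0 then - \<infinity> else ereal (ln t))"

definition log_likelihood ::
  "nat \<Rightarrow> (nat \<Rightarrow> (nat \<Rightarrow> 'y) \<Rightarrow> 'i \<Rightarrow> 'y \<Rightarrow> real) \<Rightarrow> 'i \<Rightarrow> (nat \<Rightarrow> 'y) \<Rightarrow> ereal"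
where
  "log_likelihood n F I \<eta> = (\<Sum>k=1..n. ext_ln (F k (restrict \<eta> {1..k - 1}) I (\<eta> k)))"

definition expected_log_likelihood ::
  "'s measure \<Rightarrow> (nat \<Rightarrow> 's \<Rightarrow> 'y::euclidean_space) \<Rightarrow> nat \<Rightarrow>
    (nat \<Rightarrow> (nat \<Rightarrow> 'y) \<Rightarrow> 'i \<Rightarrow> 'y \<Rightarrow> real) \<Rightarrow> 'i \<Rightarrow> ereal"
where
  "expected_log_likelihood M y n F I = ext_integral (traj_law M y n) (log_likelihood n F I)"

end

(* The one-step predictions multiply to a probability density q on the trajectories, and the
   log-likelihood of a trajectory is ln q.  Gibbs' inequality E_p[ln q] <= E_p[ln p], with equality
   iff p = q almost everywhere, gives the bound.  Finally p = q almost everywhere iff all one-step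
   conditionals agree: integrating out the last output turns p = q at length k + 1 into p = q at
   length k, and conversely p and q are rebuilt from their conditionals by induction. *)

theory Submission
  imports Defs
begin

section \<open>Gibbs' inequality for extended-real integrals\<close>

lemma measurable_ext_ln [measurable]: "ext_ln \<in> borel_measurable borel"
  unfolding ext_ln_def[abs_def] by measurable

lemma e2ennreal_ereal: "e2ennreal (ereal r) = ennreal r"
  by (simp add: ennreal.abs_eq)

text \<open>This is ln t <= t - 1 at t = Q / P, scaled by P. Equality in that bound forces t = 1,
  which gives the second part.\<close>

lemma mult_ln_le:
  fixes P Q :: real
  assumes "0 < P" "0 < Q"
  shows "P * ln Q + P \<le> P * ln P + Q"
    and "P * ln Q + P = P * ln P + Q \<Longrightarrow> P = Q"
proof -
  have *: "P * ln (Q / P) = P * ln Q - P * ln P" "P * (Q / P - 1) = Q - P"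
    using assms by (simp_all add: ln_div algebra_simps)
  have "P * ln (Q / P) \<le> P * (Q / P - 1)"
    using assms by (intro mult_left_mono ln_le_minus_one) auto
  then show "P * ln Q + P \<le> P * ln P + Q"
    using * by linarith
  assume "P * ln Q + P = P * ln P + Q"
  then have "P * ln (Q / P) = P * (Q / P - 1)"
    using * by linarith
  then have "ln (Q / P) = Q / P - 1"
    using assms by simp
  then have "Q / P = 1"
    using assms by (intro ln_eq_minus_one) auto
  then show "P = Q" by simp
qed

text \<open>
  The inequality \<open>P ln Q + P \<le> P ln P + Q\<close> with every negative part moved to the other side, so
  that both sides can be integrated whether or not the logarithms are integrable.
\<close>
lemma ennreal_mult_ln_le:
  fixes P Q :: real
  assumes "0 \<le> P" "0 \<le> Q"
  defines "l \<equiv> ennreal P * e2ennreal (ext_ln Q) + e2ennreal (- ereal (P * ln P)) + ennreal P"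
    and "r \<equiv> e2ennreal (ereal (P * ln P)) + ennreal P * e2ennreal (- ext_ln Q) + ennreal Q"
  shows "l \<le> r" and "l = r \<Longrightarrow> P = Q"
proof -
  \<comment> \<open>For positive P and Q every summand is finite, so both sides are images of reals
    and the comparison can be made there.\<close>
  have pos: "l = ennreal (P * max 0 (ln Q) + max 0 (- (P * ln P)) + P) \<and>
      r = ennreal (max 0 (P * ln P) + P * max 0 (- ln Q) + Q)" if "0 < P" "0 < Q"
  proof -
    have m: "e2ennreal (ereal t) = ennreal (max 0 t)" for t
      by (simp add: e2ennreal_ereal max_def ennreal_neg)
    have "l = ennreal P * e2ennreal (ereal (ln Q)) + e2ennreal (ereal (- (P * ln P))) + ennreal P"
      "r = e2ennreal (ereal (P * ln P)) + ennreal P * e2ennreal (ereal (- ln Q)) + ennreal Q"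
      using that by (simp_all add: l_def r_def ext_ln_def)
    then show ?thesis
      using that unfolding m by (simp add: ennreal_mult ennreal_plus)
  qed
  \<comment> \<open>A number is its positive part minus its negative part; adding these identities
    to \<open>mult_ln_le\<close> gives the comparison of the truncated terms.\<close>
  have parts: "P * max 0 (ln Q) = P * ln Q + P * max 0 (- ln Q)"
    "max 0 (P * ln P) = P * ln P + max 0 (- (P * ln P))"
    by (auto simp: max_def algebra_simps)
  \<comment> \<open>Here \<open>0 * ln 0 = 0\<close> and, in \<open>ennreal\<close>, zero times
    infinity is zero. So l is 0 and r is Q.\<close>
  have zero: "l \<le> r \<and> (l = r \<longrightarrow> P = Q)" if "P = 0"
    using that assms(2) by (auto simp: l_def r_def zero_ereal_def[symmetric] e2ennreal_neg)
  \<comment> \<open>The predicted value vanishes where P does not: the negative part of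
    \<open>ext_ln 0\<close> is infinite, so r is infinite, while l stays finite.\<close>
  have zero': "l < r" if "0 < P" "Q = 0"
  proof -
    have "e2ennreal \<infinity> = \<infinity>"
      by (metis e2ennreal_enn2ereal enn2ereal_top infinity_ennreal_def)
    then have "r = \<infinity>"
      using that by (simp add: r_def ext_ln_def ennreal_mult_top)
    moreover have "l < \<infinity>"
      using that by (simp add: l_def ext_ln_def e2ennreal_neg)
    ultimately show ?thesis by simp
  qed
  show "l \<le> r"
  proof -
    have "l \<le> r" if "0 < P" "0 < Q"
      using pos[OF that] parts mult_ln_le(1)[OF that] by (auto intro!: ennreal_leI)
    then show ?thesis
      using zero zero' assms(1,2) by (cases "P = 0"; cases "Q = 0") (auto simp: less_le)
  qed
  assume eq: "l = r"
  have "P = Q" if "0 < P" "0 < Q"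
  proof -
    have "ennreal (P * max 0 (ln Q) + max 0 (- (P * ln P)) + P) =
        ennreal (max 0 (P * ln P) + P * max 0 (- ln Q) + Q)"
      using pos[OF that] eq by metis
    then have "P * max 0 (ln Q) + max 0 (- (P * ln P)) + P = max 0 (P * ln P) + P * max 0 (- ln Q) + Q"
      using that by (subst (asm) ennreal_inj) auto
    then show ?thesis
      using parts by (intro mult_ln_le(2)[OF that]) linarith
  qed
  then show "P = Q"
    using zero zero' assms(1,2) eq by (cases "P = 0"; cases "Q = 0") (auto simp: less_le)
qed

text \<open>
  Excludes \<open>\<infinity> - \<infinity>\<close> on the left-hand side of Gibbs' inequality when the right-hand side is
  below \<open>\<infinity>\<close>.
\<close>
lemma ennreal_mult_ln_pos_le:
  fixes P Q :: real
  assumes "0 \<le> P" "0 \<le> Q"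
  shows "ennreal P * e2ennreal (ext_ln Q) \<le> e2ennreal (ereal (P * ln P)) + ennreal Q"
proof (cases "P = 0 \<or> Q \<le> 1")
  case True
  then have "ennreal P * e2ennreal (ext_ln Q) = 0"
    using assms(2) by (auto simp: ext_ln_def e2ennreal_neg e2ennreal_ereal ennreal_neg)
  then show ?thesis by (simp only: zero_le)
next
  case False
  then have pos: "0 < P" "1 < Q" using assms by auto
  have "P * ln Q \<le> max 0 (P * ln P) + Q"
    using mult_ln_le(1)[of P Q] pos by auto
  then have "ennreal (P * ln Q) \<le> ennreal (max 0 (P * ln P) + Q)"
    by (rule ennreal_leI)
  also have "\<dots> = ennreal (P * ln P) + ennreal Q"
    using pos by (simp add: ennreal_plus max_def ennreal_neg)
  finally show ?thesis
    using pos by (simp add: ext_ln_def e2ennreal_ereal ennreal_mult)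
qed

text \<open>Reconciles the two logarithms: at P = 0 the infinite \<open>ext_ln 0\<close> is
  annihilated by the factor 0, and \<open>0 * ln 0\<close> is 0 as well.\<close>

lemma ennreal_mult_ext_ln_self:
  fixes P :: real
  assumes "0 \<le> P"
  shows "ennreal P * e2ennreal (ext_ln P) = e2ennreal (ereal (P * ln P))"
    and "ennreal P * e2ennreal (- ext_ln P) = e2ennreal (- ereal (P * ln P))"
proof -
  show "ennreal P * e2ennreal (ext_ln P) = e2ennreal (ereal (P * ln P))"
    using assms by (auto simp: ext_ln_def e2ennreal_ereal ennreal_mult' zero_ereal_def[symmetric])
  show "ennreal P * e2ennreal (- ext_ln P) = e2ennreal (- ereal (P * ln P))"
    using assms by (auto simp: ext_ln_def e2ennreal_ereal ennreal_mult'[symmetric] zero_ereal_def[symmetric])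
qed

text \<open>Integrating \<open>ennreal_mult_ln_le\<close> and cancelling the two unit masses leaves
  C + B <= A + D, the subtraction-free form of C - D <= A - B. The equality clause needs a finite R:
  if R is minus infinity, the bound makes L equal to R for every Q.\<close>

lemma gibbs_inequality:
  fixes P Q :: "'a \<Rightarrow> real"
  assumes [measurable]: "P \<in> borel_measurable N" "Q \<in> borel_measurable N"
    and P0: "\<And>a. a \<in> space N \<Longrightarrow> 0 \<le> P a" and Q0: "\<And>a. a \<in> space N \<Longrightarrow> 0 \<le> Q a"
    and P1: "(\<integral>\<^sup>+ a. ennreal (P a) \<partial>N) = 1" and Q1: "(\<integral>\<^sup>+ a. ennreal (Q a) \<partial>N) = 1"
  defines "L \<equiv> ext_integral (density N (\<lambda>a. ennreal (P a))) (\<lambda>a. ext_ln (Q a))"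
    and "R \<equiv> ext_integral N (\<lambda>a. ereal (P a * ln (P a)))"
  shows "L \<le> R" and "\<bar>R\<bar> \<noteq> \<infinity> \<Longrightarrow> L = R \<longleftrightarrow> (AE a in N. P a = Q a)"
proof -
  define C where "C = (\<integral>\<^sup>+ a. ennreal (P a) * e2ennreal (ext_ln (Q a)) \<partial>N)"
  define D where "D = (\<integral>\<^sup>+ a. ennreal (P a) * e2ennreal (- ext_ln (Q a)) \<partial>N)"
  define A where "A = (\<integral>\<^sup>+ a. e2ennreal (ereal (P a * ln (P a))) \<partial>N)"
  define B where "B = (\<integral>\<^sup>+ a. e2ennreal (- ereal (P a * ln (P a))) \<partial>N)"
  have L: "L = enn2ereal C - enn2ereal D"
    unfolding L_def ext_integral_def C_def D_def by (simp add: nn_integral_density)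
  have R: "R = enn2ereal A - enn2ereal B"
    unfolding R_def ext_integral_def A_def B_def ..
  have l: "(\<integral>\<^sup>+ a. ennreal (P a) * e2ennreal (ext_ln (Q a)) + e2ennreal (- ereal (P a * ln (P a)))
      + ennreal (P a) \<partial>N) = C + B + 1" (is "integral\<^sup>N N ?l = _")
    unfolding C_def B_def P1[symmetric] by (simp add: nn_integral_add)
  have r: "(\<integral>\<^sup>+ a. e2ennreal (ereal (P a * ln (P a))) + ennreal (P a) * e2ennreal (- ext_ln (Q a))
      + ennreal (Q a) \<partial>N) = A + D + 1" (is "integral\<^sup>N N ?r = _")
    unfolding A_def D_def Q1[symmetric] by (simp add: nn_integral_add)
  have "C + B + 1 \<le> A + D + 1"
    unfolding l[symmetric] r[symmetric] using P0 Q0 by (intro nn_integral_mono ennreal_mult_ln_le)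
  then have le: "C + B \<le> A + D"
    by simp
  \<comment> \<open>If C is infinite, so is A, and then R is infinite too, as \<open>ereal\<close>
    subtraction sends infinity minus anything to infinity. Otherwise C is finite and L is not of the
    form infinity minus infinity.\<close>
  have "C \<le> (\<integral>\<^sup>+ a. e2ennreal (ereal (P a * ln (P a))) + ennreal (Q a) \<partial>N)"
    unfolding C_def using P0 Q0 by (intro nn_integral_mono ennreal_mult_ln_pos_le)
  also have "\<dots> = A + 1"
    unfolding A_def Q1[symmetric] by (simp add: nn_integral_add)
  finally have C: "C \<le> A + 1" .
  show "L \<le> R"
    unfolding L R using le C
    by (cases A; cases B; cases C; cases D)
       (auto simp: enn2ereal_ennreal ennreal_plus[symmetric] top_unique simp del: ennreal_plus)
  assume fin: "\<bar>R\<bar> \<noteq> \<infinity>"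
  show "L = R \<longleftrightarrow> (AE a in N. P a = Q a)"
  proof
    assume "L = R"
    \<comment> \<open>A finite R makes A and B finite, the bound on C makes C finite, and L = R then
      makes D finite.\<close>
    then have eq: "C + B = A + D" "A + D \<noteq> \<infinity>"
      using fin le C unfolding L R
      by (cases A; cases B; cases C; cases D;
          auto simp: enn2ereal_ennreal ennreal_plus[symmetric] top_unique simp del: ennreal_plus)+
    \<comment> \<open>The pointwise gap is nonnegative with integral 0, so it vanishes almost
      everywhere.\<close>
    have "(\<integral>\<^sup>+ a. ?r a - ?l a \<partial>N) = integral\<^sup>N N ?r - integral\<^sup>N N ?l"
    proof (rule nn_integral_diff)
      show "integral\<^sup>N N ?l \<noteq> \<infinity>"
        unfolding l using eq by simp
      show "AE a in N. ?l a \<le> ?r a"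
        using P0 Q0 by (intro AE_I2 ennreal_mult_ln_le)
    qed measurable
    also have "\<dots> = 0"
      unfolding l r eq(1) using eq(2) by (intro diff_eq_0_ennreal) (auto simp: less_top)
    finally have "AE a in N. ?r a - ?l a = 0"
      by (subst (asm) nn_integral_0_iff_AE) auto
    then show "AE a in N. P a = Q a"
      using AE_space
    proof eventually_elim
      case (elim a)
      \<comment> \<open>Subtraction in \<open>ennreal\<close> is truncated, so a zero difference
        gives only this direction; the other is the pointwise inequality.\<close>
      then have "?r a \<le> ?l a"
        by (simp add: diff_eq_0_iff_ennreal)
      then show ?case
        using elim(2) P0 Q0 by (intro ennreal_mult_ln_le(2) antisym ennreal_mult_ln_le(1))
    qed
  next
    assume eq: "AE a in N. P a = Q a"
    \<comment> \<open>Positive and negative parts agree separately, so C = A and D = B follow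
      without any subtraction.\<close>
    have "AE a in N. ennreal (P a) * e2ennreal (ext_ln (Q a)) = e2ennreal (ereal (P a * ln (P a))) \<and>
        ennreal (P a) * e2ennreal (- ext_ln (Q a)) = e2ennreal (- ereal (P a * ln (P a)))"
      using eq AE_space
    proof eventually_elim
      case (elim a)
      then show ?case
        using ennreal_mult_ext_ln_self[OF P0[OF elim(2)]] by metis
    qed
    then have "C = A" "D = B"
      unfolding A_def B_def C_def D_def by (auto intro!: nn_integral_cong_AE)
    then show "L = R"
      unfolding L R by simp
  qed
qed


section \<open>Congruence of the extended integral, and the extended logarithm of products\<close>

lemma ext_integral_cong:
  assumes "\<And>a. a \<in> space N \<Longrightarrow> g a = g' a"
  shows "ext_integral N g = ext_integral N g'"
  unfolding ext_integral_def using assms by (simp cong: nn_integral_cong)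

text \<open>Zero factors are harmless: \<open>ext_ln\<close> never takes the value plus infinity, so
  minus infinity absorbs the other summand.\<close>

lemma ext_ln_mult:
  assumes "0 \<le> a" "0 \<le> b"
  shows "ext_ln (a * b) = ext_ln a + ext_ln b"
  using assms by (auto simp: ext_ln_def ln_mult)

lemma ext_ln_prod:
  assumes "\<And>k. k \<in> A \<Longrightarrow> 0 \<le> a k"
  shows "ext_ln (\<Prod>k\<in>A. a k) = (\<Sum>k\<in>A. ext_ln (a k))"
  using assms
proof (induction A rule: infinite_finite_induct)
  case (insert k A)
  then show ?case
    by (simp add: ext_ln_mult prod_nonneg)
qed (simp_all add: ext_ln_def zero_ereal_def)

section \<open>Integration over trajectories\<close>

interpretation lborel_prod: product_sigma_finite "\<lambda>_::nat. lborel :: 'y::euclidean_space measure"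
  by standard

lemma traj_space_Suc:
  "traj_space (Suc k) = PiM (insert (Suc k) {1..k}) (\<lambda>_. lborel :: 'y::euclidean_space measure)"
  by (simp add: traj_space_def atLeastAtMostSuc_conv)

lemma traj_space_0:
  "(traj_space 0 :: (nat \<Rightarrow> 'y::euclidean_space) measure) = count_space {\<lambda>_. undefined}"
  by (simp add: traj_space_def PiM_empty)

lemma measurable_traj_upd:
  "(\<lambda>(\<eta>, z). \<eta>(Suc k := z)) \<in>
    traj_space k \<Otimes>\<^sub>M lborel \<rightarrow>\<^sub>M (traj_space (Suc k) :: (nat \<Rightarrow> 'y::euclidean_space) measure)"
  unfolding traj_space_Suc by (simp add: traj_space_def)

lemma measurable_traj_upd' [measurable]:
  "\<eta> \<in> space (traj_space k) \<Longrightarrow>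
    (\<lambda>z. \<eta>(Suc k := z)) \<in> lborel \<rightarrow>\<^sub>M (traj_space (Suc k) :: (nat \<Rightarrow> 'y::euclidean_space) measure)"
  using measurable_compose[OF measurable_Pair1' measurable_traj_upd] by simp

lemma measurable_traj_restrict:
  "j \<le> k \<Longrightarrow> (\<lambda>\<eta>. restrict \<eta> {1..j}) \<in>
    traj_space k \<rightarrow>\<^sub>M (traj_space j :: (nat \<Rightarrow> 'y::euclidean_space) measure)"
  unfolding traj_space_def by (intro measurable_restrict_subset) auto

lemma restrict_traj:
  "\<eta> \<in> space (traj_space k :: (nat \<Rightarrow> 'y::euclidean_space) measure) \<Longrightarrow> restrict \<eta> {1..k} = \<eta>"
  by (auto simp: traj_space_def space_PiM intro!: extensional_restrict)

lemma restrict_traj_upd: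
  "\<eta> \<in> space (traj_space k :: (nat \<Rightarrow> 'y::euclidean_space) measure) \<Longrightarrow>
    restrict (\<eta>(Suc k := z)) {1..k} = \<eta>"
  using restrict_traj by (simp add: restrict_fupd)

text \<open>Tonelli's theorem with the last output integrated innermost.\<close>

lemma nn_integral_traj_Suc:
  fixes g :: "(nat \<Rightarrow> 'y::euclidean_space) \<Rightarrow> ennreal"
  assumes "g \<in> borel_measurable (traj_space (Suc k))"
  shows "(\<integral>\<^sup>+ \<eta>. g \<eta> \<partial>traj_space (Suc k)) =
    (\<integral>\<^sup>+ \<eta>. (\<integral>\<^sup>+ z. g (\<eta>(Suc k := z)) \<partial>lborel) \<partial>traj_space k)"
  using assms unfolding traj_space_Suc
  by (subst lborel_prod.product_nn_integral_insert) (simp_all add: traj_space_def)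

text \<open>Tonelli applied to the indicator of the exceptional set: the set is null iff almost all
  of its sections in the last output are null.\<close>

lemma AE_traj_Suc:
  fixes A :: "(nat \<Rightarrow> 'y::euclidean_space) \<Rightarrow> bool"
  assumes [measurable]: "Measurable.pred (traj_space (Suc k)) A"
  shows "(AE \<eta> in traj_space (Suc k). A \<eta>) \<longleftrightarrow>
    (AE \<eta> in traj_space k. AE z in lborel. A (\<eta>(Suc k := z)))"
proof -
  let ?g = "\<lambda>\<eta>. indicator {\<eta>. \<not> A \<eta>} \<eta> :: ennreal"
  have g: "?g \<in> borel_measurable (traj_space (Suc k))"
    by measurable
  have g2: "(\<lambda>(\<eta>, z). ?g (\<eta>(Suc k := z))) \<in> borel_measurable (traj_space k \<Otimes>\<^sub>M lborel)"
    using measurable_compose[OF measurable_traj_upd g] by (simp add: split_beta')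
  have "(AE \<eta> in traj_space (Suc k). A \<eta>) \<longleftrightarrow>
      (\<integral>\<^sup>+ \<eta>. (\<integral>\<^sup>+ z. ?g (\<eta>(Suc k := z)) \<partial>lborel) \<partial>traj_space k) = 0"
    by (subst AE_iff_nn_integral) (simp_all flip: nn_integral_traj_Suc[OF g])
  also have "\<dots> \<longleftrightarrow> (AE \<eta> in traj_space k. (\<integral>\<^sup>+ z. ?g (\<eta>(Suc k := z)) \<partial>lborel) = 0)"
    by (intro nn_integral_0_iff_AE lborel.borel_measurable_nn_integral g2)
  also have "\<dots> \<longleftrightarrow> (AE \<eta> in traj_space k. AE z in lborel. A (\<eta>(Suc k := z)))"
  proof (intro eventually_subst, use AE_space in eventually_elim)
    case (elim \<eta>)
    then show ?case
      using measurable_compose[OF measurable_traj_upd'[OF elim] g]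
      by (subst nn_integral_0_iff_AE) (auto simp: indicator_def)
  qed
  finally show ?thesis .
qed

section \<open>Joint densities\<close>

lemma joint_densitiesD:
  fixes y :: "nat \<Rightarrow> 's \<Rightarrow> 'y::euclidean_space"
  assumes "joint_densities M y n p" "k \<le> n"
  shows "\<And>\<eta>. \<eta> \<in> space (traj_space k) \<Longrightarrow> 0 \<le> p k \<eta>"
    and "distributed M (traj_space k) (traj y k) (\<lambda>\<eta>. ennreal (p k \<eta>))"
    and "p k \<in> borel_measurable (traj_space k)"
    and "traj_law M y k = density (traj_space k) (\<lambda>\<eta>. ennreal (p k \<eta>))"
proof -
  show 1: "\<And>\<eta>. \<eta> \<in> space (traj_space k) \<Longrightarrow> 0 \<le> p k \<eta>"
    and 2: "distributed M (traj_space k) (traj y k) (\<lambda>\<eta>. ennreal (p k \<eta>))"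
    using assms by (auto simp: joint_densities_def)
  show "p k \<in> borel_measurable (traj_space k)"
    using 1 2 by (rule distributed_real_measurable)
  show "traj_law M y k = density (traj_space k) (\<lambda>\<eta>. ennreal (p k \<eta>))"
    using 2 by (simp add: traj_law_def distributed_distr_eq_density)
qed

lemma (in prob_space) nn_integral_joint_density:
  fixes y :: "nat \<Rightarrow> 'a \<Rightarrow> 'y::euclidean_space"
  assumes "joint_densities M y n p" "k \<le> n"
  shows "(\<integral>\<^sup>+ \<eta>. ennreal (p k \<eta>) \<partial>traj_space k) = 1"
  using distributed_nn_integral[OF joint_densitiesD(2)[OF assms], of "\<lambda>_. 1"]
  by (simp add: emeasure_space_1)

lemma (in prob_space) joint_density_marginal:
  fixes y :: "nat \<Rightarrow> 'a \<Rightarrow> 'y::euclidean_space"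
  assumes p: "joint_densities M y n p" and k: "Suc k \<le> n"
  shows "AE \<eta> in traj_space k. ennreal (p k \<eta>) = (\<integral>\<^sup>+ z. ennreal (p (Suc k) (\<eta>(Suc k := z))) \<partial>lborel)"
proof (rule distributed_unique)
  show d: "distributed M (traj_space k) (traj y k) (\<lambda>\<eta>. ennreal (p k \<eta>))"
    using p k by (intro joint_densitiesD) auto
  let ?m = "\<lambda>\<eta>. \<integral>\<^sup>+ z. ennreal (p (Suc k) (\<eta>(Suc k := z))) \<partial>lborel"
  have pS [measurable]: "p (Suc k) \<in> borel_measurable (traj_space (Suc k))"
    using p k by (rule joint_densitiesD)
  have t [measurable]: "traj y k \<in> M \<rightarrow>\<^sub>M traj_space k"
    using d by (simp add: distributed_def)
  have tS: "traj y (Suc k) \<in> M \<rightarrow>\<^sub>M traj_space (Suc k)"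
    using joint_densitiesD(2)[OF p k] by (simp add: distributed_def)
  have "(\<lambda>(\<eta>, z). ennreal (p (Suc k) (\<eta>(Suc k := z)))) \<in> borel_measurable (traj_space k \<Otimes>\<^sub>M lborel)"
    using measurable_compose[OF measurable_traj_upd pS] by (simp add: split_beta')
  then have m [measurable]: "?m \<in> borel_measurable (traj_space k)"
    by (rule lborel.borel_measurable_nn_integral)
  have "distr M (traj_space k) (traj y k) = density (traj_space k) ?m"
  proof (rule measure_eqI)
    fix A assume "A \<in> sets (distr M (traj_space k) (traj y k))"
    then have [measurable]: "A \<in> sets (traj_space k)" by simp
    note [measurable] = measurable_traj_restrict[of k "Suc k"]
    let ?i = "\<lambda>\<eta>. indicator A (restrict \<eta> {1..k}) :: ennreal"
    have "emeasure (distr M (traj_space k) (traj y k)) A = (\<integral>\<^sup>+ \<omega>. indicator A (traj y k \<omega>) \<partial>M)"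
      by (subst nn_integral_distr[OF t, symmetric]) simp_all
    \<comment> \<open>An event about the prefix is read as an event about the longer trajectory,
      whose density is \<open>p (Suc k)\<close>.\<close>
    also have "\<dots> = (\<integral>\<^sup>+ \<omega>. ?i (traj y (Suc k) \<omega>) \<partial>M)"
      by (simp add: traj_def restrict_restrict Int_absorb1)
    also have "\<dots> = (\<integral>\<^sup>+ \<eta>. ennreal (p (Suc k) \<eta>) * ?i \<eta> \<partial>traj_space (Suc k))"
      by (rule distributed_nn_integral[OF joint_densitiesD(2)[OF p k], symmetric]) measurable
    also have "\<dots> = (\<integral>\<^sup>+ \<eta>. (\<integral>\<^sup>+ z. ennreal (p (Suc k) (\<eta>(Suc k := z))) * ?i (\<eta>(Suc k := z)) \<partial>lborel)
        \<partial>traj_space k)"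
      by (intro nn_integral_traj_Suc) measurable
    also have "\<dots> = (\<integral>\<^sup>+ \<eta>. ?m \<eta> * indicator A \<eta> \<partial>traj_space k)"
    proof (rule nn_integral_cong)
      fix \<eta> :: "nat \<Rightarrow> 'y" assume \<eta>: "\<eta> \<in> space (traj_space k)"
      note [measurable] = measurable_traj_upd'[OF \<eta>]
      \<comment> \<open>The indicator sees only the prefix, hence is constant in z.\<close>
      show "(\<integral>\<^sup>+ z. ennreal (p (Suc k) (\<eta>(Suc k := z))) * ?i (\<eta>(Suc k := z)) \<partial>lborel) =
          ?m \<eta> * indicator A \<eta>"
        unfolding restrict_traj_upd[OF \<eta>] by (rule nn_integral_multc) measurable
    qed
    also have "\<dots> = emeasure (density (traj_space k) ?m) A"
      by (simp add: emeasure_density)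
    finally show "emeasure (distr M (traj_space k) (traj y k)) A = emeasure (density (traj_space k) ?m) A" .
  qed simp
  then show "distributed M (traj_space k) (traj y k) ?m"
    by (simp add: distributed_def)
qed

section \<open>The joint density of a predictor\<close>

text \<open>The density q on trajectories that the predictor induces by the chain rule.
  \<open>restrict\<close> cuts the trajectory to the history that \<open>F k\<close>
  expects.\<close>

definition likelihood ::
  "(nat \<Rightarrow> (nat \<Rightarrow> 'y) \<Rightarrow> 'i \<Rightarrow> 'y \<Rightarrow> real) \<Rightarrow> 'i \<Rightarrow> nat \<Rightarrow> (nat \<Rightarrow> 'y) \<Rightarrow> real"
where
  "likelihood F I n \<eta> = (\<Prod>k=1..n. F k (restrict \<eta> {1..k - 1}) I (\<eta> k))"

lemma online_predictorD:
  fixes F :: "nat \<Rightarrow> (nat \<Rightarrow> 'y::euclidean_space) \<Rightarrow> 'i \<Rightarrow> 'y \<Rightarrow> real"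
  assumes "online_predictor n F I" "Suc k \<le> n"
  shows "(\<lambda>(\<eta>, z). F (Suc k) \<eta> I z) \<in> borel_measurable (traj_space k \<Otimes>\<^sub>M lborel)"
    and "\<And>\<eta> z. \<eta> \<in> space (traj_space k) \<Longrightarrow> 0 \<le> F (Suc k) \<eta> I z"
    and "\<And>\<eta>. \<eta> \<in> space (traj_space k) \<Longrightarrow> (\<integral>\<^sup>+ z. ennreal (F (Suc k) \<eta> I z) \<partial>lborel) = 1"
  using assms unfolding online_predictor_def by (auto dest!: bspec[of _ _ "Suc k"])

lemma predictor_nonneg:
  fixes F :: "nat \<Rightarrow> (nat \<Rightarrow> 'y::euclidean_space) \<Rightarrow> 'i \<Rightarrow> 'y \<Rightarrow> real"
  assumes "online_predictor n F I" "k \<in> {1..m}" "m \<le> n" "\<eta> \<in> space (traj_space m)"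
  shows "0 \<le> F k (restrict \<eta> {1..k - 1}) I (\<eta> k)"
proof -
  obtain j where j: "k = Suc j" "Suc j \<le> n" "j \<le> m"
    using assms by (cases k) auto
  show ?thesis
    using online_predictorD(2)[OF assms(1) j(2)]
      measurable_space[OF measurable_traj_restrict[OF j(3)] assms(4)] by (simp add: j)
qed

lemma likelihood_nonneg:
  fixes F :: "nat \<Rightarrow> (nat \<Rightarrow> 'y::euclidean_space) \<Rightarrow> 'i \<Rightarrow> 'y \<Rightarrow> real"
  assumes "online_predictor n F I" "k \<le> n" "\<eta> \<in> space (traj_space k)"
  shows "0 \<le> likelihood F I k \<eta>"
  unfolding likelihood_def using assms by (intro prod_nonneg predictor_nonneg ballI) auto

lemma log_likelihood_eq:
  fixes F :: "nat \<Rightarrow> (nat \<Rightarrow> 'y::euclidean_space) \<Rightarrow> 'i \<Rightarrow> 'y \<Rightarrow> real"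
  assumes "online_predictor n F I" "\<eta> \<in> space (traj_space n)"
  shows "log_likelihood n F I \<eta> = ext_ln (likelihood F I n \<eta>)"
  unfolding likelihood_def log_likelihood_def
  using assms by (intro ext_ln_prod[symmetric] predictor_nonneg) auto

lemma measurable_likelihood:
  fixes F :: "nat \<Rightarrow> (nat \<Rightarrow> 'y::euclidean_space) \<Rightarrow> 'i \<Rightarrow> 'y \<Rightarrow> real"
  assumes "online_predictor n F I" "k \<le> n"
  shows "likelihood F I k \<in> borel_measurable (traj_space k)"
  unfolding likelihood_def[abs_def]
proof (rule borel_measurable_prod)
  fix i assume i: "i \<in> {1..k}"
  then obtain j where j: "i = Suc j" "Suc j \<le> n" "j \<le> k"
    using assms by (cases i) auto
  have "(\<lambda>\<eta>. \<eta> i) \<in> traj_space k \<rightarrow>\<^sub>M (lborel :: 'y measure)"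
    unfolding traj_space_def by (rule measurable_component_singleton[OF i])
  from measurable_compose[OF measurable_Pair[OF measurable_traj_restrict[OF j(3)] this]
      online_predictorD(1)[OF assms(1) j(2)]]
  show "(\<lambda>\<eta>. F i (restrict \<eta> {1..i - 1}) I (\<eta> i)) \<in> borel_measurable (traj_space k)"
    by (simp add: j)
qed

lemma likelihood_upd:
  fixes F :: "nat \<Rightarrow> (nat \<Rightarrow> 'y::euclidean_space) \<Rightarrow> 'i \<Rightarrow> 'y \<Rightarrow> real"
  assumes "\<eta> \<in> space (traj_space k)"
  shows "likelihood F I (Suc k) (\<eta>(Suc k := z)) = likelihood F I k \<eta> * F (Suc k) \<eta> I z"
proof -
  have "restrict (\<eta>(Suc k := z)) {1..i - 1} = restrict \<eta> {1..i - 1}" if "i \<in> {1..k}" for i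
    using that by (auto simp: restrict_def fun_eq_iff)
  then have "(\<Prod>i=1..k. F i (restrict (\<eta>(Suc k := z)) {1..i - 1}) I ((\<eta>(Suc k := z)) i)) =
      likelihood F I k \<eta>"
    unfolding likelihood_def by (intro prod.cong) auto
  then show ?thesis
    using restrict_traj_upd[OF assms, of z] by (simp add: likelihood_def[of F I "Suc k"])
qed

text \<open>Only the last factor involves the last output, and it integrates to 1. This holds for
  every history, whereas the marginals of \<open>p\<close> match only almost everywhere.\<close>

lemma nn_integral_likelihood_upd:
  fixes F :: "nat \<Rightarrow> (nat \<Rightarrow> 'y::euclidean_space) \<Rightarrow> 'i \<Rightarrow> 'y \<Rightarrow> real"
  assumes F: "online_predictor n F I" and k: "Suc k \<le> n" and \<eta>: "\<eta> \<in> space (traj_space k)"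
  shows "(\<integral>\<^sup>+ z. ennreal (likelihood F I (Suc k) (\<eta>(Suc k := z))) \<partial>lborel) = ennreal (likelihood F I k \<eta>)"
proof -
  have [measurable]: "(\<lambda>z. F (Suc k) \<eta> I z) \<in> borel_measurable lborel"
    using measurable_compose[OF measurable_Pair1'[OF \<eta>] online_predictorD(1)[OF F k]] by simp
  show ?thesis
    using online_predictorD(2,3)[OF F k \<eta>] likelihood_nonneg[OF F _ \<eta>] k
    by (simp add: likelihood_upd[OF \<eta>] ennreal_mult nn_integral_cmult)
qed

lemma nn_integral_likelihood:
  fixes F :: "nat \<Rightarrow> (nat \<Rightarrow> 'y::euclidean_space) \<Rightarrow> 'i \<Rightarrow> 'y \<Rightarrow> real"
  assumes "online_predictor n F I" "k \<le> n"
  shows "(\<integral>\<^sup>+ \<eta>. ennreal (likelihood F I k \<eta>) \<partial>traj_space k) = 1"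
  using assms(2)
proof (induction k)
  case 0
  show ?case
    by (simp add: traj_space_0 nn_integral_count_space_finite likelihood_def)
next
  case (Suc k)
  note [measurable] = measurable_likelihood[OF assms(1) Suc.prems]
  show ?case
    using Suc nn_integral_likelihood_upd[OF assms(1) Suc.prems]
    by (simp add: nn_integral_traj_Suc cong: nn_integral_cong)
qed

section \<open>Conditional and joint densities\<close>

context
  fixes M :: "'s measure" and y :: "nat \<Rightarrow> 's \<Rightarrow> 'y::euclidean_space"
    and n :: nat and p :: "nat \<Rightarrow> (nat \<Rightarrow> 'y) \<Rightarrow> real"
    and F :: "nat \<Rightarrow> (nat \<Rightarrow> 'y) \<Rightarrow> 'i \<Rightarrow> 'y \<Rightarrow> real" and I :: 'i
  assumes M: "prob_space M" and p: "joint_densities M y n p" and F: "online_predictor n F I"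
begin

lemma pred_joint_density_eq_likelihood:
  assumes "k \<le> n"
  shows "Measurable.pred (traj_space k) (\<lambda>\<eta>. p k \<eta> = likelihood F I k \<eta>)"
  unfolding pred_def
  by (intro borel_measurable_eq joint_densitiesD(3)[OF p assms] measurable_likelihood[OF F assms])

text \<open>Where \<open>p k\<close> is positive, dividing by \<open>p k\<close>, which equals the
  likelihood of the history, turns joint equality into conditional equality. The remaining histories
  are null under the law of the trajectory.\<close>

lemma joint_density_Suc_eq_likelihood_iff:
  assumes k: "Suc k \<le> n"
    and eq: "AE \<eta> in traj_space k. p k \<eta> = likelihood F I k \<eta>"
  shows "(AE \<eta> in traj_space (Suc k). p (Suc k) \<eta> = likelihood F I (Suc k) \<eta>) \<longleftrightarrow>
    (AE \<eta> in traj_law M y k. AE z in lborel. cond_density p (Suc k) \<eta> z = F (Suc k) \<eta> I z)"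
proof -
  note [measurable] = joint_densitiesD(3)[OF p] measurable_likelihood[OF F]
  have "(AE \<eta> in traj_space (Suc k). p (Suc k) \<eta> = likelihood F I (Suc k) \<eta>) \<longleftrightarrow>
      (AE \<eta> in traj_space k. AE z in lborel.
        p (Suc k) (\<eta>(Suc k := z)) = likelihood F I (Suc k) (\<eta>(Suc k := z)))"
    using k by (intro AE_traj_Suc pred_joint_density_eq_likelihood)
  \<comment> \<open>Almost everywhere under the law means Lebesgue almost everywhere on the set
    where \<open>p k\<close> is positive.\<close>
  also have "\<dots> \<longleftrightarrow> (AE \<eta> in traj_space k. 0 < ennreal (p k \<eta>) \<longrightarrow>
      (AE z in lborel. cond_density p (Suc k) \<eta> z = F (Suc k) \<eta> I z))"
  proof (intro eventually_subst,
      use eq prob_space.joint_density_marginal[OF M p k] AE_space in eventually_elim)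
    case (elim \<eta>)
    have [measurable]: "(\<lambda>z. p (Suc k) (\<eta>(Suc k := z))) \<in> borel_measurable lborel"
      using measurable_compose[OF measurable_traj_upd'[OF elim(3)] joint_densitiesD(3)[OF p k]] .
    have pos: "0 \<le> p (Suc k) (\<eta>(Suc k := z))" for z
      using measurable_space[OF measurable_traj_upd'[OF elim(3)], of z] joint_densitiesD(1)[OF p k]
      by simp
    show ?case
    proof (cases "0 < p k \<eta>")
      case True
      then show ?thesis
        using elim(1) by (simp add: likelihood_upd[OF elim(3)] cond_density_def field_simps)
    next
      \<comment> \<open>The marginal identity makes \<open>p (Suc k)\<close> vanish for almost every
        z, and the likelihood vanishes through its factor for the history, so the joint equality
        holds on its own.\<close>
      case False
      then have "p k \<eta> = 0"
        using joint_densitiesD(1)[OF p _ elim(3)] k by force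
      then have "(\<integral>\<^sup>+ z. ennreal (p (Suc k) (\<eta>(Suc k := z))) \<partial>lborel) = 0"
        using elim(2) by simp
      then have "AE z in lborel. p (Suc k) (\<eta>(Suc k := z)) = 0"
        using pos by (subst (asm) nn_integral_0_iff_AE) (auto simp: ennreal_eq_0_iff intro: antisym)
      then show ?thesis
        using False elim(1) \<open>p k \<eta> = 0\<close> by (simp add: likelihood_upd[OF elim(3)])
    qed
  qed
  also have "\<dots> \<longleftrightarrow>
      (AE \<eta> in traj_law M y k. AE z in lborel. cond_density p (Suc k) \<eta> z = F (Suc k) \<eta> I z)"
    using k by (subst joint_densitiesD(4)[OF p]) (simp_all add: AE_density)
  finally show ?thesis .
qed

text \<open>The space of empty trajectories is one point of mass 1, so \<open>p 0\<close> must be 1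
  there, the value of the empty product.\<close>

lemma joint_density_0_eq_likelihood:
  "AE \<eta> in traj_space 0. p 0 \<eta> = likelihood F I 0 \<eta>"
  using prob_space.nn_integral_joint_density[OF M p, of 0]
  unfolding traj_space_0
  by (simp add: nn_integral_count_space_finite likelihood_def AE_count_space)

text \<open>Downward induction from \<open>n\<close>: both families are consistent under integrating
  out the last output.\<close>

lemma joint_density_eq_likelihood_mono:
  assumes "AE \<eta> in traj_space n. p n \<eta> = likelihood F I n \<eta>" and "k \<le> n"
  shows "AE \<eta> in traj_space k. p k \<eta> = likelihood F I k \<eta>"
  using assms(2)
proof (induction rule: inc_induct)
  case base
  show ?case by (fact assms)
next
  case (step k)
  then have k: "Suc k \<le> n" by simp
  have "AE \<eta> in traj_space k. AE z in lborel.
      p (Suc k) (\<eta>(Suc k := z)) = likelihood F I (Suc k) (\<eta>(Suc k := z))"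
    using step.IH AE_traj_Suc[OF pred_joint_density_eq_likelihood[OF k]] by simp
  then show ?case
    using prob_space.joint_density_marginal[OF M p k] AE_space
  proof eventually_elim
    case (elim \<eta>)
    from elim(1) have "(\<integral>\<^sup>+ z. ennreal (p (Suc k) (\<eta>(Suc k := z))) \<partial>lborel) =
        (\<integral>\<^sup>+ z. ennreal (likelihood F I (Suc k) (\<eta>(Suc k := z))) \<partial>lborel)"
      by (intro nn_integral_cong_AE) auto
    then show ?case
      using elim(2) nn_integral_likelihood_upd[OF F k elim(3)] k
        joint_densitiesD(1)[OF p _ elim(3)] likelihood_nonneg[OF F _ elim(3)] by simp
  qed
qed

lemma joint_density_eq_likelihood_iff:
  "(AE \<eta> in traj_space n. p n \<eta> = likelihood F I n \<eta>) \<longleftrightarrow>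
    (\<forall>k\<in>{1..n}. AE \<eta> in traj_law M y (k - 1). AE z in lborel. cond_density p k \<eta> z = F k \<eta> I z)"
  (is "?joint \<longleftrightarrow> (\<forall>k\<in>_. ?cond k)")
proof
  assume *: ?joint
  show "\<forall>k\<in>{1..n}. ?cond k"
  proof
    fix k assume "k \<in> {1..n}"
    then obtain j where j: "k = Suc j" "Suc j \<le> n" by (cases k) auto
    have "?cond (Suc j)"
      \<comment> \<open>Agreement is used at both lengths j and \<open>Suc j\<close>: the former is
        the premise of the equivalence, the latter its left side.\<close>
      using j(2) joint_density_Suc_eq_likelihood_iff[OF j(2)] joint_density_eq_likelihood_mono[OF *]
      unfolding diff_Suc_1 by simp
    then show "?cond k"
      unfolding j(1) .
  qed
next
  assume *: "\<forall>k\<in>{1..n}. ?cond k"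
  \<comment> \<open>Upward induction: agreement at length k is the premise that lets the next
    conditional equality yield length \<open>Suc k\<close>.\<close>
  have "AE \<eta> in traj_space k. p k \<eta> = likelihood F I k \<eta>" if "k \<le> n" for k
    using that
  proof (induction k)
    case 0
    show ?case by (rule joint_density_0_eq_likelihood)
  next
    case (Suc k)
    then show ?case
      using joint_density_Suc_eq_likelihood_iff[OF Suc.prems] bspec[OF *, of "Suc k"]
      unfolding diff_Suc_1 by simp
  qed
  then show ?joint by simp
qed

end

theorem corollary1:
  fixes M :: "'s measure"
    and f :: "real ^ 'dx \<Rightarrow> real ^ 'du \<Rightarrow> real ^ 'dx"
    and h :: "real ^ 'dx \<Rightarrow> real ^ 'dy"
    and x w :: "nat \<Rightarrow> 's \<Rightarrow> real ^ 'dx"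
    and u :: "nat \<Rightarrow> 's \<Rightarrow> real ^ 'du"
    and v y :: "nat \<Rightarrow> 's \<Rightarrow> real ^ 'dy"
    and n :: nat
    and p :: "nat \<Rightarrow> (nat \<Rightarrow> real ^ 'dy) \<Rightarrow> real"
    and F :: "nat \<Rightarrow> (nat \<Rightarrow> real ^ 'dy) \<Rightarrow> 'i \<Rightarrow> real ^ 'dy \<Rightarrow> real"
    and I :: 'i
  assumes "stochastic_system M f h x u w v y"
    and "joint_densities M y n p"
    and "online_predictor n F I"
  shows "expected_log_likelihood M y n F I \<le> - diff_entropy n p \<and>
    (\<bar>diff_entropy n p\<bar> \<noteq> \<infinity> \<longrightarrow>
      (expected_log_likelihood M y n F I = - diff_entropy n p \<longleftrightarrow>
        (\<forall>k\<in>{1..n}. AE \<eta> in traj_law M y (k - 1). AE z in lborel.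
          cond_density p k \<eta> z = F k \<eta> I z)))"
proof -
  note p = assms(2) and F = assms(3)
  have M: "prob_space M"
    using assms(1) by (simp add: stochastic_system_def)
  have L: "expected_log_likelihood M y n F I =
      ext_integral (density (traj_space n) (\<lambda>\<eta>. ennreal (p n \<eta>))) (\<lambda>\<eta>. ext_ln (likelihood F I n \<eta>))"
    unfolding expected_log_likelihood_def joint_densitiesD(4)[OF p order_refl]
    by (intro ext_integral_cong) (simp add: log_likelihood_eq[OF F])
  have R: "- diff_entropy n p = ext_integral (traj_space n) (\<lambda>\<eta>. ereal (p n \<eta> * ln (p n \<eta>)))"
    by (simp add: diff_entropy_def)
  \<comment> \<open>Gibbs' inequality with P the true density \<open>p n\<close> and Q the
    likelihood; its finiteness condition is on minus the entropy, equivalent to that on the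
    entropy.\<close>
  note gibbs = gibbs_inequality[OF joint_densitiesD(3)[OF p order_refl]
      measurable_likelihood[OF F order_refl] joint_densitiesD(1)[OF p order_refl]
      likelihood_nonneg[OF F order_refl] prob_space.nn_integral_joint_density[OF M p order_refl]
      nn_integral_likelihood[OF F order_refl], folded L R]
  show ?thesis
    using gibbs joint_density_eq_likelihood_iff[OF M p F] by simp
qed

end
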